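(* For every integer $n\ge6$, let $\Delta^4_n$ be the pure $4$-dimensional simplicial complex on the vertex set $\{\pm1,\dots,\pm n\}$ whose facets are the following five-element sets together with their antipodal images (images under $x\mapsto -x$): (1)(i) $\{i,i+1,n-2,n-1,n\}$ and $\{-i,-i-1,n-2,n-1,n\}$ for $1\le i\le n-4$; (1)(ii) $\{1,-(n-3),n-2,n-1,n\}$, $\{1,-(n-3),-(n-2),n-1,n\}$, $\{1,-(n-3),-(n-2),-(n-1),n\}$, $\{1,-(n-3),-(n-2),-(n-1),-n\}$; (2)(i) $\{i,i+1,\ell-3,\ell-2,\ell\}$, $\{i,i+1,\ell-3,\ell-1,\ell\}$, $\{-i,-i-1,\ell-3,\ell-2,\ell\}$, $\{-i,-i-1,\ell-3,\ell-1,\ell\}$ for $1\le i\le \ell-5\le n-5$; (2)(ii) $\{1,-(\ell-4),\ell-3,\ell-2,\ell\}$, $\{1,-(\ell-4),\ell-3,\ell-1,\ell\}$, $\{1,-(\ell-4),-(\ell-3),\ell-2,\ell\}$, $\{1,-(\ell-4),-(\ell-2),\ell-1,\ell\}$, $\{1,-(\ell-4),-(\ell-2),-(\ell-1),\ell\}$, $\{1,-(\ell-4),-(\ell-3),-(\ell-1),\ell\}$, $\{-(\ell-4),-(\ell-3),-(\ell-2),\ell-1,\ell\}$, $\{-(\ell-4),-(\ell-3),-(\ell-2),-(\ell-1),\ell\}$ for $6\le\ell\le n$; (3) $\{-1,2,-3,4,-5\}$, $\{1,2,-3,4,-5\}$, $\{1,2,3,4,-5\}$, $\{1,2,3,-4,-5\}$,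 $\{1,-2,-3,4,-5\}$, $\{1,-2,3,4,-5\}$, $\{1,-2,3,-4,-5\}$, $\{-1,-2,-3,4,-5\}$, $\{-1,-2,3,4,-5\}$, $\{-1,-2,3,-4,-5\}$. Then $\Delta^4_n$ is not realizable: there is no convex $5$-polytope whose boundary complex is combinatorially isomorphic to $\Delta^4_n$.
   Context: $\Delta^4_n$ is Novik and Zheng's centrally symmetric cs-$2$-neighborly combinatorial $4$-sphere on $2n$ vertices; the facets in (1) form the ball $B^{4,1}_n$. *)

theory Defs
  imports "HOL-Analysis.Analysis"
begin

definition antipode :: "int set \<Rightarrow> int set" where
  "antipode S = uminus ` S"

definition NZ_gen :: "int \<Rightarrow> int set set" where
  "NZ_gen n =
     \<comment> \<open>(1)(i)\<close>
     {{i, i+1, n-2, n-1, n} | i. 1 \<le> i \<and> i \<le> n-4}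
   \<union> {{-i, -i-1, n-2, n-1, n} | i. 1 \<le> i \<and> i \<le> n-4}
     \<comment> \<open>(1)(ii)\<close>
   \<union> {{1, -(n-3), n-2, n-1, n}, {1, -(n-3), -(n-2), n-1, n},
      {1, -(n-3), -(n-2), -(n-1), n}, {1, -(n-3), -(n-2), -(n-1), -n}}
     \<comment> \<open>(2)(i)\<close>
   \<union> {F. \<exists>i l. 1 \<le> i \<and> i \<le> l-5 \<and> l-5 \<le> n-5 \<and>
          F \<in> {{i, i+1, l-3, l-2, l}, {i, i+1, l-3, l-1, l},
                {-i, -i-1, l-3, l-2, l}, {-i, -i-1, l-3, l-1, l}}}
     \<comment> \<open>(2)(ii)\<close>
   \<union> {F. \<exists>l. 6 \<le> l \<and> l \<le> n \<and>
          F \<in> {{1, -(l-4), l-3, l-2, l}, {1, -(l-4), l-3, l-1, l},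
                {1, -(l-4), -(l-3), l-2, l}, {1, -(l-4), -(l-2), l-1, l},
                {1, -(l-4), -(l-2), -(l-1), l}, {1, -(l-4), -(l-3), -(l-1), l},
                {-(l-4), -(l-3), -(l-2), l-1, l}, {-(l-4), -(l-3), -(l-2), -(l-1), l}}}
     \<comment> \<open>(3)\<close>
   \<union> {{-1,2,-3,4,-5}, {1,2,-3,4,-5}, {1,2,3,4,-5}, {1,2,3,-4,-5}, {1,-2,-3,4,-5},
      {1,-2,3,4,-5}, {1,-2,3,-4,-5}, {-1,-2,-3,4,-5}, {-1,-2,3,4,-5}, {-1,-2,3,-4,-5}}"

definition NZ_facets :: "int \<Rightarrow> int set set" where
  "NZ_facets n = NZ_gen n \<union> antipode ` NZ_gen n"

definition complex_faces :: "'v set set \<Rightarrow> 'v set set" where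
  "complex_faces K = {S. \<exists>F\<in>K. S \<subseteq> F}"

text \<open>Boundary complex of a polytope P: all proper faces (including the empty face).\<close>
definition boundary_faces :: "'a::euclidean_space set \<Rightarrow> 'a set set" where
  "boundary_faces P = {G. G face_of P \<and> G \<noteq> P}"

definition realizable_5 :: "'v set set \<Rightarrow> bool" where
  "realizable_5 K \<longleftrightarrow>
     (\<exists>P :: (real^5) set. polytope P \<and> aff_dim P = 5 \<and>
        (\<exists>\<phi>. bij_betw \<phi> (complex_faces K) (boundary_faces P) \<and>
             (\<forall>S\<in>complex_faces K. \<forall>T\<in>complex_faces K. S \<subseteq> T \<longleftrightarrow> \<phi> S \<subseteq> \<phi> T)))"

end

theory Submission
  imports Defs
begin

text \<open>
  Homogenise the vertices of a hypothetical realization to vectors of \<open>\<real>\<^sup>6\<close> and write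
  \<open>[v\<^sub>1 \<dots> v\<^sub>6]\<close> for their determinants. If \<open>F\<close> is a facet, all brackets \<open>[F v]\<close> with
  \<open>v \<notin> F\<close> have the same nonzero sign, and adjacent facets share a bracket, so one sign fixes the signs of
  all these brackets. The complexes for all \<open>n \<ge> 6\<close> have in common the facets of type (3) and
  those of type (2) with \<open>\<ell> = 6\<close>, together with their antipodes. The signs these facets prescribe
  already violate the three-term Grassmann-Pluecker relations
  \<open>[A a b][A c d] - [A a c][A b d] + [A a d][A b c] = 0\<close>: as soon as two of the three terms have the
  same known sign, the third has the opposite one, which determines the sign of a further bracket.
  Nineteen such steps lead to a relation all of whose terms are positive.
\<close>

section \<open>Determinants as functions of their rows\<close>

text \<open>With the rows given as a function, replacing a row is a function update.\<close>

definition row_det :: "('n::finite \<Rightarrow> real^'n) \<Rightarrow> real" where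
  "row_det r = det (\<chi> i. r i)"

lemma linear_row_det:
  fixes r :: "'n::finite \<Rightarrow> real^'n"
  shows "linear (\<lambda>x. row_det (r(p := x)))"
proof (rule linearI)
  fix x y :: "real^'n" and c :: real
  have eq: "row_det (r(p := z)) = det (\<chi> i. if i = p then z else r i)" for z
    by (simp add: row_det_def fun_upd_def)
  show "row_det (r(p := x + y)) = row_det (r(p := x)) + row_det (r(p := y))"
    unfolding eq using det_row_add[of p "\<lambda>_. x" "\<lambda>_. y" r] by simp
  show "row_det (r(p := c *\<^sub>R x)) = c *\<^sub>R row_det (r(p := x))"
    unfolding eq using det_row_mul[of p c "\<lambda>_. x" r] unfolding scalar_mult_eq_scaleR by simp
qed

lemma row_det_eq_rows:
  assumes "i \<noteq> j" "r i = r j"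
  shows "row_det r = 0"
  unfolding row_det_def using assms by (intro det_identical_rows[of i j]) (auto simp: row_def)

text \<open>Polarization: the form is bilinear in the two rows and vanishes when they agree, so
  expanding it with \<open>x + y\<close> in both places leaves only the two mixed terms.\<close>

lemma row_det_swap:
  assumes "p \<noteq> q"
  shows "row_det (r(p := y, q := x)) = - row_det (r(p := x, q := y))"
proof -
  let ?D = "\<lambda>x y. row_det (r(p := x, q := y))"
  have l1: "linear (\<lambda>x. ?D x y)" for y
    using linear_row_det[of "r(q := y)" p] assms by (simp add: fun_upd_twist)
  have l2: "linear (\<lambda>y. ?D x y)" for x
    using linear_row_det[of "r(p := x)" q] by simp
  have z: "?D x x = 0" for x
    using assms by (intro row_det_eq_rows[of p q]) auto
  have "0 = ?D (x + y) (x + y)" using z by simp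
  also have "\<dots> = ?D x x + ?D x y + ?D y x + ?D y y"
    by (simp add: linear_add[OF l1] linear_add[OF l2])
  finally show ?thesis using z by simp
qed

lemma row_det_nz_independent:
  assumes "inj r" "independent (range r)"
  shows "row_det r \<noteq> 0"
proof
  let ?A = "\<chi> i. r i"
  assume "row_det r = 0"
  then have "\<not> (\<exists>B. ?A ** B = mat 1)"
    by (metis invertible_det_nz invertible_right_inverse row_det_def)
  then obtain c i where c: "(\<Sum>i\<in>UNIV. c i *s r i) = 0" "c i \<noteq> 0"
    unfolding matrix_right_invertible_independent_rows by (auto simp: row_def)
  \<comment> \<open>Independence is a property of sets, so the relation between rows is reindexed
    over \<open>range r\<close>, which injectivity permits.\<close>
  have "(\<Sum>v\<in>range r. c (inv r v) *\<^sub>R v) = 0"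
    using c(1) assms(1) by (simp add: sum.reindex scalar_mult_eq_scaleR)
  then have "c (inv r (r i)) = 0"
    using assms(2) independentD[of "range r" "range r" "\<lambda>v. c (inv r v)" "r i"] by simp
  then show False using c(2) assms(1) by simp
qed

text \<open>Multiplying \<open>x\<close> by the inverse matrix yields its coordinates with respect
  to the rows.\<close>

lemma row_det_nz_expand:
  assumes "row_det r \<noteq> 0"
  obtains u where "x = (\<Sum>i\<in>UNIV. u i *\<^sub>R r i)"
proof -
  let ?A = "\<chi> i. r i"
  obtain B where "B ** ?A = mat 1"
    using assms by (metis invertible_det_nz invertible_left_inverse row_det_def)
  then have "x v* B v* ?A = x"
    by (simp add: vector_matrix_mul_assoc)
  moreover have "y v* ?A = (\<Sum>i\<in>UNIV. (y $ i) *\<^sub>R r i)" for y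
    by (simp add: vec_eq_iff vector_matrix_mult_def mult.commute)
  ultimately show ?thesis using that by metis
qed

text \<open>If \<open>D a b\<close> is nonzero, then \<open>a\<close>, \<open>b\<close> and the
  remaining rows form a basis; expanding \<open>c\<close> in it turns the relation into an identity.
  Each term contains one of \<open>D a b\<close>, \<open>D a c\<close>, \<open>D a d\<close>. If one
  of these is nonzero, relabelling reduces to the first situation; if all vanish, so does every
  term.\<close>

lemma Grassmann_Pluecker_3_term:
  fixes r :: "'n::finite \<Rightarrow> real^'n"
  assumes "p \<noteq> q"
  defines "D \<equiv> \<lambda>x y. row_det (r(p := x, q := y))"
  shows "D a b * D c d - D a c * D b d + D a d * D b c = 0"
proof -
  have l1: "linear (\<lambda>x. D x y)" for y
    using linear_row_det[of "r(q := y)" p] assms(1) by (simp add: D_def fun_upd_twist)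
  have sw: "D y x = - D x y" for x y
    unfolding D_def by (rule row_det_swap[OF assms(1)])
  have main: "D a b * D c d - D a c * D b d + D a d * D b c = 0" if nz: "D a b \<noteq> 0" for a b c d
  proof -
    define r' where "r' = r(p := a, q := b)"
    obtain u where u: "c = (\<Sum>i\<in>UNIV. u i *\<^sub>R r' i)"
      using row_det_nz_expand[of r' c] nz unfolding D_def r'_def by metis
    have ex: "D c y = u p * D a y + u q * D b y" for y
    proof -
      have "D c y = (\<Sum>i\<in>UNIV. u i * D (r' i) y)"
        by (simp add: u linear_sum[OF l1] linear_cmul[OF l1])
      also have "\<dots> = (\<Sum>i\<in>{p,q}. u i * D (r' i) y)"
      proof (intro sum.mono_neutral_right ballI)
        fix i assume "i \<in> UNIV - {p, q}"
        \<comment> \<open>Here \<open>r' i = r i\<close>, so rows \<open>p\<close> and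
          \<open>i\<close> coincide.\<close>
        then have "D (r' i) y = 0" unfolding D_def
          using assms(1) by (intro row_det_eq_rows[of p i]) (auto simp: r'_def)
        then show "u i * D (r' i) y = 0" by simp
      qed auto
      also have "\<dots> = u p * D a y + u q * D b y"
        using assms(1) by (simp add: r'_def)
      finally show ?thesis .
    qed
    have zz: "D x x = 0" for x using sw[of x x] by simp
    \<comment> \<open>Setting \<open>y\<close> to \<open>a\<close> and to \<open>b\<close> in the
      expansion gives the two coefficients up to the factor \<open>D a b\<close>.\<close>
    have "D a c = u q * D a b" "D b c = - u p * D a b"
      using ex[of a] ex[of b] sw[of a c] sw[of b c] sw[of a b] zz by auto
    then show ?thesis by (simp add: ex algebra_simps)
  qed
  consider "D a b \<noteq> 0" | "D a b = 0" "D a c \<noteq> 0" | "D a b = 0" "D a c = 0" "D a d \<noteq> 0"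
    | "D a b = 0" "D a c = 0" "D a d = 0" by blast
  then show ?thesis
  proof cases
    case 1 then show ?thesis by (rule main)
  next
    case 2
    then show ?thesis using main[of a c b d] sw[of b c] by auto
  next
    case 3
    then show ?thesis using main[of a d b c] by auto
  qed simp
qed

text \<open>In the expansion of \<open>x\<close> in the rows of \<open>r\<close>, applying
  \<open>L\<close> leaves only the coefficient of \<open>r p\<close>, which is therefore positive.
  The determinant with \<open>x\<close> in place of \<open>r p\<close> is this coefficient times
  \<open>row_det r\<close>, so the product is a positive multiple of a square.\<close>

lemma row_det_same_side:
  fixes r :: "'n::finite \<Rightarrow> real^'n" and L :: "real^'n \<Rightarrow> real"
  assumes L: "linear L" "\<And>i. i \<noteq> p \<Longrightarrow> L (r i) = 0" "0 < L (r p)" "0 < L x"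
    and ind: "inj_on r (- {p})" "independent (r ` (- {p}))"
  shows "0 < row_det r * row_det (r(p := x))"
proof -
  have "L y = 0" if "y \<in> span (r ` (- {p}))" for y
    using that by (rule linear_eq_0_on_span[OF L(1), rotated]) (use L(2) in auto)
  then have p: "r p \<notin> span (r ` (- {p}))" using L(3) by force
  have U: "UNIV = insert p (- {p})" by auto
  have "row_det r \<noteq> 0"
  proof (rule row_det_nz_independent)
    show "independent (range r)"
      using p ind(2) by (subst U) (simp add: independent_insert)
    show "inj r"
      using p ind(1) span_base[of "r p" "r ` (- {p})"] by (subst U) (simp only: inj_on_insert, blast)
  qed
  then obtain u where u: "x = (\<Sum>i\<in>UNIV. u i *\<^sub>R r i)"
    using row_det_nz_expand by metis
  have "L x = (\<Sum>i\<in>UNIV. u i * L (r i))"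
    by (simp add: u linear_sum[OF L(1)] linear_cmul[OF L(1)])
  also have "\<dots> = (\<Sum>i\<in>{p}. u i * L (r i))"
    by (rule sum.mono_neutral_right) (use L(2) in auto)
  finally have "0 < u p" using L(3,4) by (simp add: zero_less_mult_iff)
  have "row_det (r(p := x)) = (\<Sum>i\<in>UNIV. u i * row_det (r(p := r i)))"
    by (simp add: u linear_sum[OF linear_row_det] linear_cmul[OF linear_row_det])
  also have "\<dots> = (\<Sum>i\<in>{p}. u i * row_det (r(p := r i)))"
  proof (intro sum.mono_neutral_right ballI)
    fix i assume "i \<in> UNIV - {p}"
    then have "row_det (r(p := r i)) = 0"
      by (intro row_det_eq_rows[of p i]) auto
    then show "u i * row_det (r(p := r i)) = 0" by simp
  qed auto
  finally have eq: "row_det r * row_det (r(p := x)) = u p * (row_det r)\<^sup>2"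
    by (simp add: power2_eq_square)
  show ?thesis
    unfolding eq using \<open>0 < u p\<close> \<open>row_det r \<noteq> 0\<close> by (intro mult_pos_pos) simp_all
qed

section \<open>Brackets of six vectors\<close>

text \<open>All six indices of the type \<open>6\<close> are overwritten, so the default row 0 never
  survives.\<close>

definition bracket :: "real^6 \<Rightarrow> real^6 \<Rightarrow> real^6 \<Rightarrow> real^6 \<Rightarrow> real^6 \<Rightarrow> real^6 \<Rightarrow> real" where
  "bracket a b c d e f =
     row_det ((\<lambda>_. 0)(0 := a, 1 := b, 2 := c, 3 := d, 4 := e, 5 := f))"

lemma distinct_6: "distinct [0, 1, 2, 3, 4, 5 :: 6]"
  by simp

lemma UNIV_6: "(UNIV :: 6 set) = {0, 1, 2, 3, 4, 5}"
  by (rule card_subset_eq[symmetric]) simp_all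

text \<open>Adjacent transpositions generate all permutations, so these five rules suffice to sort
  the arguments.\<close>

lemma bracket_swap:
  "bracket b a c d e f = - bracket a b c d e f"
  "bracket a c b d e f = - bracket a b c d e f"
  "bracket a b d c e f = - bracket a b c d e f"
  "bracket a b c e d f = - bracket a b c d e f"
  "bracket a b c d f e = - bracket a b c d e f"
proof -
  let ?r = "(\<lambda>_. 0)(0 := a, 1 := b, 2 := c, 3 := d, 4 := e, 5 := f) :: 6 \<Rightarrow> real^6"
  show "bracket b a c d e f = - bracket a b c d e f"
    using row_det_swap[of 0 1 ?r b a] unfolding bracket_def by (simp add: fun_upd_twist)
  show "bracket a c b d e f = - bracket a b c d e f"
    using row_det_swap[of 1 2 ?r c b] unfolding bracket_def by (simp add: fun_upd_twist)
  show "bracket a b d c e f = - bracket a b c d e f"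
    using row_det_swap[of 2 3 ?r d c] unfolding bracket_def by (simp add: fun_upd_twist)
  show "bracket a b c e d f = - bracket a b c d e f"
    using row_det_swap[of 3 4 ?r e d] unfolding bracket_def by (simp add: fun_upd_twist)
  show "bracket a b c d f e = - bracket a b c d e f"
    using row_det_swap[of 4 5 ?r f e] unfolding bracket_def by (simp add: fun_upd_twist)
qed

lemma bracket_Grassmann_Pluecker:
  "bracket s t u v a b * bracket s t u v c d - bracket s t u v a c * bracket s t u v b d
   + bracket s t u v a d * bracket s t u v b c = 0"
  unfolding bracket_def by (rule Grassmann_Pluecker_3_term) simp

lemma bracket_same_side:
  fixes L :: "real^6 \<Rightarrow> real"
  assumes "linear L" "L a = 0" "L b = 0" "L c = 0" "L d = 0" "L e = 0" "0 < L x" "0 < L y"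
    and "distinct [a, b, c, d, e]" "independent {a, b, c, d, e}"
  shows "0 < bracket a b c d e x * bracket a b c d e y"
proof -
  let ?r = "(\<lambda>_. 0)(0 := a, 1 := b, 2 := c, 3 := d, 4 := e, 5 := x) :: 6 \<Rightarrow> real^6"
  have U: "- {5} = {0, 1, 2, 3, 4 :: 6}"
    using UNIV_6 distinct_6 by (auto simp: Compl_eq_Diff_UNIV)
  have "0 < row_det ?r * row_det (?r(5 := y))"
  proof (rule row_det_same_side[OF assms(1)])
    show "L (?r i) = 0" if "i \<noteq> 5" for i
    proof -
      have "i \<in> {0, 1, 2, 3, 4}" using that U by blast
      then show ?thesis using assms by auto
    qed
  qed (use assms in \<open>auto simp: U inj_on_def\<close>)
  then show ?thesis by (simp add: bracket_def)
qed

section \<open>The combinatorial certificate\<close>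

text \<open>
  The vertices of each facet are listed in an order for which all brackets \<open>[F v]\<close> are positive,
  once the first one is. These 26 facets are connected by adjacency and suffice for the certificate.
\<close>

definition core_facets :: "(int \<times> int \<times> int \<times> int \<times> int) set" where
  "core_facets =
    {(-5, -3, -2, 1, 6),
     (-4, -5, -3, -2, 6),
     (-4, -5, -2, 1, 6),
     (-3, -5, -2, 1, 4),
     (-3, -2, 1, 4, 6),
     (-3, -4, -2, 5, 6),
     (-2, -4, 1, 5, 6),
     (-3, -4, -2, -1, 5),
     (-2, 1, 3, 5, 6),
     (-6, -4, -3, -2, -1),
     (-2, -3, -1, 4, 5),
     (-1, -2, 3, 5, 6),
     (1, 2, 3, 5, 6),
     (-5, -6, -3, -2, -1),
     (-1, -3, 2, 4, 5),
     (-2, -1, 3, 4, 6),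
     (2, 1, 3, 4, 6),
     (-6, -1, 2, 4, 5),
     (-3, 1, 2, 4, 5),
     (-2, -5, -1, 3, 4),
     (-5, 1, 2, 3, 4),
     (-4, -3, 1, 2, 5),
     (-4, -5, -2, -1, 3),
     (-5, -4, 1, 2, 3),
     (-4, -6, -3, 1, 2),
     (-6, -5, -3, 1, 2)}"

text \<open>These vertices are present for every \<open>n\<close> from 6 on.\<close>

definition core_vertices :: "int set" where
  "core_vertices = {-6, -5, -4, -3, -2, -1, 1, 2, 3, 4, 5, 6}"

text \<open>Isolates the properties of the brackets on which the contradiction rests. Stating
  \<open>facet\<close> with products leaves the global orientation open and makes the assumptions
  invariant under negating \<open>C\<close>.\<close>

locale chirotope =
  fixes C :: "int \<Rightarrow> int \<Rightarrow> int \<Rightarrow> int \<Rightarrow> int \<Rightarrow> int \<Rightarrow> real"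
  assumes swap:
      "C b a c d e f = - C a b c d e f" "C a c b d e f = - C a b c d e f"
      "C a b d c e f = - C a b c d e f" "C a b c e d f = - C a b c d e f"
      "C a b c d f e = - C a b c d e f"
    and GP: "C s t u v a b * C s t u v c d - C s t u v a c * C s t u v b d
      + C s t u v a d * C s t u v b c = 0"
    and facet: "\<lbrakk>(a, b, c, d, e) \<in> core_facets;
      v \<in> core_vertices - {a, b, c, d, e}; w \<in> core_vertices - {a, b, c, d, e}\<rbrakk>
      \<Longrightarrow> 0 < C a b c d e v * C a b c d e w"
begin

text \<open>Unconditional swaps would loop; with these side conditions the simplifier sorts numeral
  arguments increasingly, so brackets on the same six vertices agree up to sign.\<close>

lemma sort:
  "b < a \<Longrightarrow> C a b c d e f = - C b a c d e f" "c < b \<Longrightarrow> C a b c d e f = - C a c b d e f"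
  "d < c \<Longrightarrow> C a b c d e f = - C a b d c e f" "e < d \<Longrightarrow> C a b c d e f = - C a b c e d f"
  "f < e \<Longrightarrow> C a b c d e f = - C a b c d f e"
  by (rule swap)+

lemma facet_pos:
  assumes "0 < C a b c d e v" "(a, b, c, d, e) \<in> core_facets"
    "v \<in> core_vertices - {a, b, c, d, e}" "w \<in> core_vertices - {a, b, c, d, e}"
  shows "0 < C a b c d e w"
  using facet[OF assms(2-4)] assms(1) by (simp add: zero_less_mult_iff)

text \<open>The shape of a Grassmann-Pluecker relation in which \<open>y\<close> is the undetermined
  bracket and the other five are known to be positive.\<close>

lemma GP_pos:
  assumes "x * y = p * q + r * s" "0 < x" "0 < p" "0 < q" "0 < r" "0 < (s::real)"
  shows "0 < y"
proof (rule zero_less_mult_pos)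
  show "0 < x * y" using assms by (simp add: add_pos_pos)
qed (fact assms(2))

text \<open>
  \<open>F\<close>: orientations propagated along adjacent facets; \<open>K\<close>: brackets
  containing a facet; \<open>D\<close>: brackets forced by a Grassmann-Pluecker relation. Permuting the first two
  arguments where necessary makes every bracket in the list positive. The sequence of relations was found
  by computer search.
\<close>

lemma not_pos: "\<not> 0 < C (-5) (-3) (-2) 1 6 (-1)"
proof
  assume base: "0 < C (-5) (-3) (-2) 1 6 (-1)"
  have F0: "0 < C (-5) (-3) (-2) 1 6 w" if "w \<in> core_vertices - {-5, -3, -2, 1, 6}" for w
    by (rule facet_pos[OF base _ _ that]) (simp_all add: core_facets_def core_vertices_def)
  \<comment> \<open>Two adjacent facets have six vertices together, so a bracket of the old facet
    is, up to order, one of the new facet. The facts \<open>B\<close> carry the sign across; the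
    facts \<open>F\<close> then spread it to all other vertices.\<close>
  have B1: "0 < C (-4) (-5) (-3) (-2) 6 1"
    using F0[of "-4"] by (simp add: sort core_vertices_def)
  have F1: "0 < C (-4) (-5) (-3) (-2) 6 w" if "w \<in> core_vertices - {-4, -5, -3, -2, 6}" for w
    by (rule facet_pos[OF B1 _ _ that]) (simp_all add: core_facets_def core_vertices_def)
  have B2: "0 < C (-4) (-5) (-2) 1 6 (-3)"
    using F0[of "-4"] by (simp add: sort core_vertices_def)
  have F2: "0 < C (-4) (-5) (-2) 1 6 w" if "w \<in> core_vertices - {-4, -5, -2, 1, 6}" for w
    by (rule facet_pos[OF B2 _ _ that]) (simp_all add: core_facets_def core_vertices_def)
  have B3: "0 < C (-3) (-5) (-2) 1 4 6"
    using F0[of 4] by (simp add: sort core_vertices_def)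
  have F3: "0 < C (-3) (-5) (-2) 1 4 w" if "w \<in> core_vertices - {-3, -5, -2, 1, 4}" for w
    by (rule facet_pos[OF B3 _ _ that]) (simp_all add: core_facets_def core_vertices_def)
  have B4: "0 < C (-3) (-2) 1 4 6 (-5)"
    using F0[of 4] by (simp add: sort core_vertices_def)
  have F4: "0 < C (-3) (-2) 1 4 6 w" if "w \<in> core_vertices - {-3, -2, 1, 4, 6}" for w
    by (rule facet_pos[OF B4 _ _ that]) (simp_all add: core_facets_def core_vertices_def)
  have B5: "0 < C (-3) (-4) (-2) 5 6 (-5)"
    using F1[of 5] by (simp add: sort core_vertices_def)
  have F5: "0 < C (-3) (-4) (-2) 5 6 w" if "w \<in> core_vertices - {-3, -4, -2, 5, 6}" for w
    by (rule facet_pos[OF B5 _ _ that]) (simp_all add: core_facets_def core_vertices_def)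
  have B6: "0 < C (-2) (-4) 1 5 6 (-5)"
    using F2[of 5] by (simp add: sort core_vertices_def)
  have F6: "0 < C (-2) (-4) 1 5 6 w" if "w \<in> core_vertices - {-2, -4, 1, 5, 6}" for w
    by (rule facet_pos[OF B6 _ _ that]) (simp_all add: core_facets_def core_vertices_def)
  have B7: "0 < C (-3) (-4) (-2) (-1) 5 6"
    using F5[of "-1"] by (simp add: sort core_vertices_def)
  have F7: "0 < C (-3) (-4) (-2) (-1) 5 w" if "w \<in> core_vertices - {-3, -4, -2, -1, 5}" for w
    by (rule facet_pos[OF B7 _ _ that]) (simp_all add: core_facets_def core_vertices_def)
  have B8: "0 < C (-2) 1 3 5 6 (-4)"
    using F6[of 3] by (simp add: sort core_vertices_def)
  have F8: "0 < C (-2) 1 3 5 6 w" if "w \<in> core_vertices - {-2, 1, 3, 5, 6}" for w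
    by (rule facet_pos[OF B8 _ _ that]) (simp_all add: core_facets_def core_vertices_def)
  have B9: "0 < C (-6) (-4) (-3) (-2) (-1) 5"
    using F7[of "-6"] by (simp add: sort core_vertices_def)
  have F9: "0 < C (-6) (-4) (-3) (-2) (-1) w" if "w \<in> core_vertices - {-6, -4, -3, -2, -1}" for w
    by (rule facet_pos[OF B9 _ _ that]) (simp_all add: core_facets_def core_vertices_def)
  have B10: "0 < C (-2) (-3) (-1) 4 5 (-4)"
    using F7[of 4] by (simp add: sort core_vertices_def)
  have F10: "0 < C (-2) (-3) (-1) 4 5 w" if "w \<in> core_vertices - {-2, -3, -1, 4, 5}" for w
    by (rule facet_pos[OF B10 _ _ that]) (simp_all add: core_facets_def core_vertices_def)
  have B11: "0 < C (-1) (-2) 3 5 6 1"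
    using F8[of "-1"] by (simp add: sort core_vertices_def)
  have F11: "0 < C (-1) (-2) 3 5 6 w" if "w \<in> core_vertices - {-1, -2, 3, 5, 6}" for w
    by (rule facet_pos[OF B11 _ _ that]) (simp_all add: core_facets_def core_vertices_def)
  have B12: "0 < C 1 2 3 5 6 (-2)"
    using F8[of 2] by (simp add: sort core_vertices_def)
  have F12: "0 < C 1 2 3 5 6 w" if "w \<in> core_vertices - {1, 2, 3, 5, 6}" for w
    by (rule facet_pos[OF B12 _ _ that]) (simp_all add: core_facets_def core_vertices_def)
  have B13: "0 < C (-5) (-6) (-3) (-2) (-1) (-4)"
    using F9[of "-5"] by (simp add: sort core_vertices_def)
  have F13: "0 < C (-5) (-6) (-3) (-2) (-1) w" if "w \<in> core_vertices - {-5, -6, -3, -2, -1}" for w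
    by (rule facet_pos[OF B13 _ _ that]) (simp_all add: core_facets_def core_vertices_def)
  have B14: "0 < C (-1) (-3) 2 4 5 (-2)"
    using F10[of 2] by (simp add: sort core_vertices_def)
  have F14: "0 < C (-1) (-3) 2 4 5 w" if "w \<in> core_vertices - {-1, -3, 2, 4, 5}" for w
    by (rule facet_pos[OF B14 _ _ that]) (simp_all add: core_facets_def core_vertices_def)
  have B15: "0 < C (-2) (-1) 3 4 6 5"
    using F11[of 4] by (simp add: sort core_vertices_def)
  have F15: "0 < C (-2) (-1) 3 4 6 w" if "w \<in> core_vertices - {-2, -1, 3, 4, 6}" for w
    by (rule facet_pos[OF B15 _ _ that]) (simp_all add: core_facets_def core_vertices_def)
  have B16: "0 < C 2 1 3 4 6 5"
    using F12[of 4] by (simp add: sort core_vertices_def)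
  have F16: "0 < C 2 1 3 4 6 w" if "w \<in> core_vertices - {2, 1, 3, 4, 6}" for w
    by (rule facet_pos[OF B16 _ _ that]) (simp_all add: core_facets_def core_vertices_def)
  have B17: "0 < C (-6) (-1) 2 4 5 (-3)"
    using F14[of "-6"] by (simp add: sort core_vertices_def)
  have F17: "0 < C (-6) (-1) 2 4 5 w" if "w \<in> core_vertices - {-6, -1, 2, 4, 5}" for w
    by (rule facet_pos[OF B17 _ _ that]) (simp_all add: core_facets_def core_vertices_def)
  have B18: "0 < C (-3) 1 2 4 5 (-1)"
    using F14[of 1] by (simp add: sort core_vertices_def)
  have F18: "0 < C (-3) 1 2 4 5 w" if "w \<in> core_vertices - {-3, 1, 2, 4, 5}" for w
    by (rule facet_pos[OF B18 _ _ that]) (simp_all add: core_facets_def core_vertices_def)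
  have B19: "0 < C (-2) (-5) (-1) 3 4 6"
    using F15[of "-5"] by (simp add: sort core_vertices_def)
  have F19: "0 < C (-2) (-5) (-1) 3 4 w" if "w \<in> core_vertices - {-2, -5, -1, 3, 4}" for w
    by (rule facet_pos[OF B19 _ _ that]) (simp_all add: core_facets_def core_vertices_def)
  have B20: "0 < C (-5) 1 2 3 4 6"
    using F16[of "-5"] by (simp add: sort core_vertices_def)
  have F20: "0 < C (-5) 1 2 3 4 w" if "w \<in> core_vertices - {-5, 1, 2, 3, 4}" for w
    by (rule facet_pos[OF B20 _ _ that]) (simp_all add: core_facets_def core_vertices_def)
  have B21: "0 < C (-4) (-3) 1 2 5 4"
    using F18[of "-4"] by (simp add: sort core_vertices_def)
  have F21: "0 < C (-4) (-3) 1 2 5 w" if "w \<in> core_vertices - {-4, -3, 1, 2, 5}" for w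
    by (rule facet_pos[OF B21 _ _ that]) (simp_all add: core_facets_def core_vertices_def)
  have B22: "0 < C (-4) (-5) (-2) (-1) 3 4"
    using F19[of "-4"] by (simp add: sort core_vertices_def)
  have F22: "0 < C (-4) (-5) (-2) (-1) 3 w" if "w \<in> core_vertices - {-4, -5, -2, -1, 3}" for w
    by (rule facet_pos[OF B22 _ _ that]) (simp_all add: core_facets_def core_vertices_def)
  have B23: "0 < C (-5) (-4) 1 2 3 4"
    using F20[of "-4"] by (simp add: sort core_vertices_def)
  have F23: "0 < C (-5) (-4) 1 2 3 w" if "w \<in> core_vertices - {-5, -4, 1, 2, 3}" for w
    by (rule facet_pos[OF B23 _ _ that]) (simp_all add: core_facets_def core_vertices_def)
  have B24: "0 < C (-4) (-6) (-3) 1 2 5"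
    using F21[of "-6"] by (simp add: sort core_vertices_def)
  have F24: "0 < C (-4) (-6) (-3) 1 2 w" if "w \<in> core_vertices - {-4, -6, -3, 1, 2}" for w
    by (rule facet_pos[OF B24 _ _ that]) (simp_all add: core_facets_def core_vertices_def)
  have B25: "0 < C (-6) (-5) (-3) 1 2 (-4)"
    using F24[of "-5"] by (simp add: sort core_vertices_def)
  have F25: "0 < C (-6) (-5) (-3) 1 2 w" if "w \<in> core_vertices - {-6, -5, -3, 1, 2}" for w
    by (rule facet_pos[OF B25 _ _ that]) (simp_all add: core_facets_def core_vertices_def)
  have K0: "0 < C (-5) (-4) (-3) (-2) 1 6"
      "0 < C (-5) (-3) (-2) (-1) 1 6"
      "0 < C (-3) (-5) (-2) 1 5 6"
    using F0[of "-4"] F0[of "-1"] F0[of 5]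
    by (simp_all add: sort core_vertices_def)
  have K1: "0 < C (-5) (-4) (-3) (-2) (-1) 6"
    using F1[of "-1"]
    by (simp_all add: sort core_vertices_def)
  have K2: "0 < C (-4) (-5) (-2) (-1) 1 6"
      "0 < C (-5) (-4) (-2) 1 5 6"
    using F2[of "-1"] F2[of 5]
    by (simp_all add: sort core_vertices_def)
  have K3: "0 < C (-3) (-5) (-2) 1 4 5"
    using F3[of 5]
    by (simp_all add: sort core_vertices_def)
  have K4: "0 < C (-2) (-3) (-1) 1 4 6"
      "0 < C (-3) (-2) 1 2 4 6"
      "0 < C (-2) (-3) 1 4 5 6"
    using F4[of "-1"] F4[of 2] F4[of 5]
    by (simp_all add: sort core_vertices_def)
  have K5: "0 < C (-3) (-4) (-2) (-1) 5 6"
      "0 < C (-3) (-4) (-2) 1 5 6"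
      "0 < C (-3) (-4) (-2) 3 5 6"
    using F5[of "-1"] F5[of 1] F5[of 3]
    by (simp_all add: sort core_vertices_def)
  have K6: "0 < C (-4) (-2) (-1) 1 5 6"
      "0 < C (-2) (-4) 1 2 5 6"
      "0 < C (-2) (-4) 1 4 5 6"
    using F6[of "-1"] F6[of 2] F6[of 4]
    by (simp_all add: sort core_vertices_def)
  have K7: "0 < C (-4) (-3) (-2) (-1) 1 5"
    using F7[of 1]
    by (simp_all add: sort core_vertices_def)
  have K8: "0 < C (-2) (-3) 1 3 5 6"
    using F8[of "-3"]
    by (simp_all add: sort core_vertices_def)
  have K9: "0 < C (-6) (-5) (-4) (-3) (-2) (-1)"
      "0 < C (-6) (-4) (-3) (-2) (-1) 1"
      "0 < C (-6) (-4) (-3) (-2) (-1) 6"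
    using F9[of "-5"] F9[of 1] F9[of 6]
    by (simp_all add: sort core_vertices_def)
  have K10: "0 < C (-6) (-3) (-2) (-1) 4 5"
      "0 < C (-2) (-3) (-1) 1 4 5"
      "0 < C (-2) (-3) (-1) 2 4 5"
      "0 < C (-2) (-3) (-1) 4 5 6"
    using F10[of "-6"] F10[of 1] F10[of 2] F10[of 6]
    by (simp_all add: sort core_vertices_def)
  have K11: "0 < C (-3) (-2) (-1) 3 5 6"
      "0 < C (-1) (-2) 3 4 5 6"
    using F11[of "-3"] F11[of 4]
    by (simp_all add: sort core_vertices_def)
  have K12: "0 < C 1 (-4) 2 3 5 6"
      "0 < C 1 (-3) 2 3 5 6"
      "0 < C 1 2 3 4 5 6"
    using F12[of "-4"] F12[of "-3"] F12[of 4]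
    by (simp_all add: sort core_vertices_def)
  have K13: "0 < C (-5) (-6) (-3) (-2) (-1) 6"
    using F13[of 6]
    by (simp_all add: sort core_vertices_def)
  have K14: "0 < C (-3) (-1) 1 2 4 5"
    using F14[of 1]
    by (simp_all add: sort core_vertices_def)
  have K15: "0 < C (-2) (-3) (-1) 3 4 6"
      "0 < C (-1) (-2) 1 3 4 6"
    using F15[of "-3"] F15[of 1]
    by (simp_all add: sort core_vertices_def)
  have K16: "0 < C (-3) 1 2 3 4 6"
      "0 < C (-2) 1 2 3 4 6"
    using F16[of "-3"] F16[of "-2"]
    by (simp_all add: sort core_vertices_def)
  have K17: "0 < C (-6) (-2) (-1) 2 4 5"
      "0 < C (-1) (-6) 1 2 4 5"
    using F17[of "-2"] F17[of 1]
    by (simp_all add: sort core_vertices_def)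
  have K18: "0 < C (-3) (-6) 1 2 4 5"
      "0 < C (-3) (-5) 1 2 4 5"
      "0 < C (-3) (-4) 1 2 4 5"
      "0 < C (-3) (-2) 1 2 4 5"
      "0 < C (-3) 1 2 4 5 6"
    using F18[of "-6"] F18[of "-5"] F18[of "-4"] F18[of "-2"] F18[of 6]
    by (simp_all add: sort core_vertices_def)
  have K20: "0 < C (-5) (-6) 1 2 3 4"
    using F20[of "-6"]
    by (simp_all add: sort core_vertices_def)
  have K21: "0 < C (-3) (-4) (-2) 1 2 5"
      "0 < C (-4) (-3) 1 2 5 6"
    using F21[of "-2"] F21[of 6]
    by (simp_all add: sort core_vertices_def)
  have K22: "0 < C (-6) (-5) (-4) (-2) (-1) 3"
      "0 < C (-5) (-4) (-3) (-2) (-1) 3"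
      "0 < C (-4) (-5) (-2) (-1) 3 6"
    using F22[of "-6"] F22[of "-3"] F22[of 6]
    by (simp_all add: sort core_vertices_def)
  have K23: "0 < C (-5) (-6) (-4) 1 2 3"
    using F23[of "-6"]
    by (simp_all add: sort core_vertices_def)
  have K24: "0 < C (-5) (-6) (-4) (-3) 1 2"
      "0 < C (-4) (-6) (-3) 1 2 4"
    using F24[of "-5"] F24[of 4]
    by (simp_all add: sort core_vertices_def)
  have K25: "0 < C (-6) (-5) (-3) 1 2 3"
      "0 < C (-6) (-5) (-3) 1 2 4"
    using F25[of 3] F25[of 4]
    by (simp_all add: sort core_vertices_def)
  \<comment> \<open>The relation with common part 1, 2, 5, 6 and the vertices 3, -3, 4, -4. The
    first fact passed to \<open>GP_pos\<close> is the known cofactor of the new bracket, the other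
    four are the factors of the two known products. All steps up to \<open>D19\<close> follow this
    scheme.\<close>
  have D1: "0 < C (-4) 1 2 4 5 6"
    by (rule GP_pos[OF _ K12(2) K12(3) K21(2) K12(1) K18(5)])
      (use GP[of 1 2 5 6 3 "-3" 4 "-4"] in \<open>simp add: sort algebra_simps\<close>)
  have D2: "0 < C (-4) (-2) 1 2 4 5"
    by (rule GP_pos[OF _ K21(2) K21(1) D1 K6(2) K18(3)])
      (use GP[of 1 2 "-4" 5 "-2" "-3" 4 6] in \<open>simp add: sort algebra_simps\<close>)
  have D3: "0 < C (-5) (-6) (-4) 1 2 4"
    by (rule GP_pos[OF _ K25(1) K20 K24(1) K23 K25(2)])
      (use GP[of 1 2 "-5" "-6" 3 "-3" 4 "-4"] in \<open>simp add: sort algebra_simps\<close>)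
  have D4: "0 < C (-1) (-2) 1 4 5 6"
    by (rule GP_pos[OF _ K15(1) K15(2) K10(4) K4(1) K11(2)])
      (use GP[of "-1" "-2" 4 6 1 3 "-3" 5] in \<open>simp add: sort algebra_simps\<close>)
  have D5: "0 < C (-2) 1 2 4 5 6"
    by (rule GP_pos[OF _ K16(1) K16(2) K18(5) K4(2) K12(3)])
      (use GP[of 1 2 4 6 "-2" 3 "-3" 5] in \<open>simp add: sort algebra_simps\<close>)
  have D6: "0 < C (-3) (-2) (-1) 1 5 6"
    by (rule GP_pos[OF _ K5(3) K8 K5(1) K5(2) K11(1)])
      (use GP[of "-2" "-3" 5 6 1 "-1" 3 "-4"] in \<open>simp add: sort algebra_simps\<close>)
  have D7: "0 < C (-6) (-5) (-4) (-2) (-1) 6"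
    by (rule GP_pos[OF _ K22(2) K22(3) K9(1) K22(1) K1])
      (use GP[of "-1" "-2" "-4" "-5" 3 "-3" 6 "-6"] in \<open>simp add: sort algebra_simps\<close>)
  have D8: "0 < C (-2) (-5) 1 4 5 6"
    by (rule GP_pos[OF _ K5(2) K4(3) K2(2) K0(3) K6(3)])
      (use GP[of 1 "-2" 5 6 "-3" 4 "-4" "-5"] in \<open>simp add: sort algebra_simps\<close>)
  have D9: "0 < C (-5) (-2) 1 2 4 5"
    by (rule GP_pos[OF _ K4(3) K18(4) D8 D5 K3])
      (use GP[of 1 "-2" 4 5 2 "-3" "-5" 6] in \<open>simp add: sort algebra_simps\<close>)
  have D10: "0 < C (-4) (-3) (-2) (-1) 1 6"
    by (rule GP_pos[OF _ K0(3) D6 K0(1) K0(2) K5(2)])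
      (use GP[of 1 "-2" "-3" 6 "-1" "-4" 5 "-5"] in \<open>simp add: sort algebra_simps\<close>)
  have D11: "0 < C (-4) (-6) (-2) (-1) 1 6"
    by (rule GP_pos[OF _ K1 D10 D7 K2(1) K9(3)])
      (use GP[of "-1" "-2" "-4" 6 1 "-3" "-5" "-6"] in \<open>simp add: sort algebra_simps\<close>)
  have D12: "0 < C (-6) (-3) (-2) (-1) 1 6"
    by (rule GP_pos[OF _ K1 D10 K13 K0(2) K9(3)])
      (use GP[of "-1" "-2" "-3" 6 1 "-4" "-5" "-6"] in \<open>simp add: sort algebra_simps\<close>)
  have D13: "0 < C (-6) (-3) (-2) (-1) 1 5"
    by (rule GP_pos[OF _ D10 K7 D12 K9(2) D6])
      (use GP[of 1 "-1" "-2" "-3" "-4" 5 6 "-6"] in \<open>simp add: sort algebra_simps\<close>)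
  have D14: "0 < C (-6) (-2) (-1) 1 5 6"
    by (rule GP_pos[OF _ D10 D6 D11 D12 K6(1)])
      (use GP[of 1 "-1" "-2" 6 "-3" "-4" 5 "-6"] in \<open>simp add: sort algebra_simps\<close>)
  have D15: "0 < C (-2) (-6) (-1) 1 4 5"
    by (rule GP_pos[OF _ D6 K10(2) D14 D13 D4])
      (use GP[of 1 "-1" "-2" 5 "-3" 4 6 "-6"] in \<open>simp add: sort algebra_simps\<close>)
  have D16: "0 < C (-2) (-1) 1 2 4 5"
    by (rule GP_pos[OF _ K10(1) K10(2) K17(1) D15 K10(3)])
      (use GP[of "-1" "-2" 4 5 1 2 "-3" "-6"] in \<open>simp add: sort algebra_simps\<close>)
  have D17: "0 < C (-2) (-6) 1 2 4 5"
    by (rule GP_pos[OF _ K14 D16 K18(1) K17(2) K18(4)])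
      (use GP[of 1 2 4 5 "-1" "-2" "-3" "-6"] in \<open>simp add: sort algebra_simps\<close>)
  have D18: "0 < C (-5) (-6) 1 2 4 5"
    by (rule GP_pos[OF _ K18(4) D9 K18(1) D17 K18(2)])
      (use GP[of 1 2 4 5 "-2" "-3" "-5" "-6"] in \<open>simp add: sort algebra_simps\<close>)
  have D19: "0 < C (-6) (-4) 1 2 4 5"
    by (rule GP_pos[OF _ K25(2) K24(2) D18 K18(1) D3])
      (use GP[of 1 2 4 "-6" "-3" "-4" 5 "-5"] in \<open>simp add: sort algebra_simps\<close>)
  \<comment> \<open>The relation with common part 1, 2, 4, 5 and the vertices -2, -3, -4, -6, each
    bracket written in its positive order: three positive products would sum to zero.\<close>
  have "C (-3) (-2) 1 2 4 5 * C (-6) (-4) 1 2 4 5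
      + C (-4) (-2) 1 2 4 5 * C (-3) (-6) 1 2 4 5
      + C (-2) (-6) 1 2 4 5 * C (-3) (-4) 1 2 4 5 = 0"
    using GP[of 1 2 4 5 "-2" "-3" "-4" "-6"] by (simp add: sort algebra_simps)
  moreover have "0 < C (-3) (-2) 1 2 4 5 * C (-6) (-4) 1 2 4 5"
    "0 < C (-4) (-2) 1 2 4 5 * C (-3) (-6) 1 2 4 5"
    "0 < C (-2) (-6) 1 2 4 5 * C (-3) (-4) 1 2 4 5"
    using K18(4) D19 D2 K18(1) D17 K18(3) by simp_all
  ultimately show False by linarith
qed

text \<open>The swap rules are linear in \<open>C\<close> and the other assumptions quadratic, so
  all survive a global change of sign. This covers the opposite orientation.\<close>

lemma chirotope_neg: "chirotope (\<lambda>a b c d e f. - C a b c d e f)"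
  by unfold_locales
    ((rule arg_cong[of _ _ uminus], rule swap)+,
      (simp only: minus_mult_minus GP facet)+)

lemma inconsistent: False
proof -
  let ?c = "C (-5) (-3) (-2) 1 6 (-1)"
  \<comment> \<open>Taking the same vertex twice in \<open>facet\<close> shows that the starting
    bracket is nonzero.\<close>
  have "0 < ?c * ?c"
    by (rule facet) (simp_all add: core_facets_def core_vertices_def)
  then have "?c \<noteq> 0" by auto
  then show False
    using not_pos chirotope.not_pos[OF chirotope_neg] by linarith
qed

end

section \<open>Homogenization\<close>

text \<open>The last coordinate of a linear relation among the vectors \<open>(x, 1)\<close> says
  that its coefficients sum to zero, which makes it an affine relation among the points.\<close>

lemma independent_homogenize:
  fixes S :: "'a::euclidean_space set"
  assumes "\<not> affine_dependent S"
  shows "independent ((\<lambda>x. (x, 1::real)) ` S)"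
proof -
  have fin: "finite S" using assms aff_independent_finite by blast
  have inj: "inj_on (\<lambda>x. (x, 1::real)) S" by (auto simp: inj_on_def)
  show ?thesis
  proof (rule independent_if_scalars_zero)
    show "finite ((\<lambda>x. (x, 1::real)) ` S)" using fin by simp
    fix f y assume 0: "(\<Sum>y\<in>(\<lambda>x. (x, 1::real)) ` S. f y *\<^sub>R y) = 0" and y: "y \<in> (\<lambda>x. (x, 1::real)) ` S"
    define u where "u x = f (x, 1)" for x
    have "(\<Sum>x\<in>S. (u x *\<^sub>R x, u x)) = 0"
      using 0 by (simp add: sum.reindex[OF inj] u_def)
    then have "fst (\<Sum>x\<in>S. (u x *\<^sub>R x, u x)) = 0" "snd (\<Sum>x\<in>S. (u x *\<^sub>R x, u x)) = 0"
      by simp_all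
    then have "sum u S = 0" "(\<Sum>x\<in>S. u x *\<^sub>R x) = 0"
      by (simp_all add: fst_sum snd_sum)
    then have "\<forall>x\<in>S. u x = 0"
      using assms affine_dependent_explicit_finite[OF fin] by auto
    then show "f y = 0" using y by (auto simp: u_def)
  qed
qed

section \<open>Recovering vertices and facets from a face poset isomorphism\<close>

text \<open>Here \<open>\<phi>\<close> is merely an isomorphism of posets; that it comes from a map
  of vertices has to be derived. Positive dimension ensures that the empty face and the vertices are
  proper faces.\<close>

locale realization =
  fixes K :: "'v set set" and P :: "'a::euclidean_space set" and \<phi> :: "'v set \<Rightarrow> 'a set"
  assumes poly: "polytope P" and dim: "0 < aff_dim P" and ne: "K \<noteq> {}"
    and bij: "bij_betw \<phi> (complex_faces K) (boundary_faces P)"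
    and iso: "\<lbrakk>S \<in> complex_faces K; T \<in> complex_faces K\<rbrakk> \<Longrightarrow> S \<subseteq> T \<longleftrightarrow> \<phi> S \<subseteq> \<phi> T"
begin

lemma face: "S \<in> complex_faces K \<Longrightarrow> \<phi> S face_of P \<and> \<phi> S \<noteq> P"
  using bij by (auto simp: bij_betw_def boundary_faces_def)

lemma faceE:
  assumes "G face_of P" "G \<noteq> P"
  obtains S where "S \<in> complex_faces K" "G = \<phi> S"
  using bij assms by (auto simp: bij_betw_def boundary_faces_def)

lemma sub_face: "\<lbrakk>S \<in> complex_faces K; T \<subseteq> S\<rbrakk> \<Longrightarrow> T \<in> complex_faces K"
  by (auto simp: complex_faces_def)

text \<open>The empty set is the least element of both posets.\<close>

lemma image_empty: "\<phi> {} = {}"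
proof -
  have "{} \<in> complex_faces K" using ne by (auto simp: complex_faces_def)
  moreover obtain S where "S \<in> complex_faces K" "{} = \<phi> S"
    by (rule faceE[of "{}"]) (use dim in auto)
  ultimately show ?thesis using iso by blast
qed

lemma image_nonempty: "\<lbrakk>S \<in> complex_faces K; S \<noteq> {}\<rbrakk> \<Longrightarrow> \<phi> S \<noteq> {}"
  using iso[of S "{}"] sub_face[of S "{}"] image_empty by auto

lemma convex_hull_face:
  assumes "S \<in> complex_faces K"
  shows "\<phi> S = convex hull {y. y extreme_point_of \<phi> S}"
proof -
  have "polytope (\<phi> S)" using face[OF assms] face_of_polytope_polytope[OF poly] by blast
  then show ?thesis
    by (intro Krein_Milman_Minkowski polytope_imp_compact polytope_imp_convex)
qed

text \<open>An extreme point of a face is a vertex of \<open>P\<close>, so \<open>{y}\<close> is the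
  image of some nonempty \<open>T\<close>. For any \<open>i\<close> in \<open>T\<close>, the image
  of \<open>{i}\<close> is a nonempty subset of \<open>{y}\<close>.\<close>

lemma extreme_pointE:
  assumes "S \<in> complex_faces K" "y extreme_point_of \<phi> S"
  obtains i where "i \<in> S" "\<phi> {i} = {y}"
proof -
  have "{y} face_of P"
    using assms face by (meson extreme_point_of_face face_of_singleton)
  moreover have "{y} \<noteq> P" using dim by auto
  ultimately obtain T where T: "T \<in> complex_faces K" "{y} = \<phi> T" by (rule faceE)
  then have "T \<noteq> {}" using image_empty by auto
  then obtain i where i: "i \<in> T" by blast
  have iK: "{i} \<in> complex_faces K" using sub_face T(1) i by blast
  have "\<phi> {i} \<subseteq> {y}" using iso[OF iK T(1)] T(2) i by auto
  then have *: "\<phi> {i} = {y}" using image_nonempty[OF iK] by auto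
  have "y \<in> \<phi> S" using assms(2) by (auto simp: extreme_point_of_def)
  then have "{i} \<subseteq> S" using iso[OF iK assms(1)] * by auto
  with * show ?thesis using that by auto
qed

definition vertex :: "'v \<Rightarrow> 'a" where
  "vertex i = the_elem (\<phi> {i})"

text \<open>A nonempty polytope has an extreme point, and the only index available for it is
  \<open>i\<close>.\<close>

lemma image_singleton:
  assumes "{i} \<in> complex_faces K"
  shows "\<phi> {i} = {vertex i}"
proof -
  have "{y. y extreme_point_of \<phi> {i}} \<noteq> {}"
    using convex_hull_face[OF assms] image_nonempty[OF assms] by auto
  then obtain y where "y extreme_point_of \<phi> {i}" by blast
  then obtain j where "j \<in> {i}" "\<phi> {j} = {y}" by (rule extreme_pointE[OF assms])
  then show ?thesis by (simp add: vertex_def)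
qed

lemma vertex_mem_iff:
  assumes "S \<in> complex_faces K" "{i} \<in> complex_faces K"
  shows "vertex i \<in> \<phi> S \<longleftrightarrow> i \<in> S"
  using iso[OF assms(2,1)] image_singleton[OF assms(2)] by simp

lemma inj_on_vertex:
  assumes "S \<in> complex_faces K"
  shows "inj_on vertex S"
proof (rule inj_onI)
  fix i j assume *: "i \<in> S" "j \<in> S" "vertex i = vertex j"
  then have "{i} \<in> complex_faces K" "{j} \<in> complex_faces K"
    using sub_face[OF assms] by auto
  then show "i = j"
    using vertex_mem_iff[of "{j}" i] *(3) image_singleton[of j] by auto
qed

lemma face_eq_convex_hull:
  assumes "S \<in> complex_faces K"
  shows "\<phi> S = convex hull (vertex ` S)"
proof
  have "{y. y extreme_point_of \<phi> S} \<subseteq> vertex ` S"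
  proof
    fix y assume "y \<in> {y. y extreme_point_of \<phi> S}"
    then have "y extreme_point_of \<phi> S" by simp
    then obtain i where "i \<in> S" "\<phi> {i} = {y}" by (rule extreme_pointE[OF assms])
    then show "y \<in> vertex ` S" by (intro image_eqI[of _ _ i]) (simp_all add: vertex_def)
  qed
  then show "\<phi> S \<subseteq> convex hull (vertex ` S)"
    using convex_hull_face[OF assms] hull_mono by metis
  have "vertex ` S \<subseteq> \<phi> S"
    using vertex_mem_iff[OF assms] sub_face[OF assms] by auto
  moreover have "convex (\<phi> S)" using face[OF assms] face_of_imp_convex by blast
  ultimately show "convex hull (vertex ` S) \<subseteq> \<phi> S" by (rule hull_minimal)
qed

text \<open>The face \<open>\<phi> F\<close> lies in a facet of \<open>P\<close>, which is itself
  the image of some \<open>T\<close> containing \<open>F\<close>; maximality of \<open>F\<close>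
  forces equality.\<close>

lemma maximal_face_facet:
  assumes "F \<in> K" "F \<noteq> {}" and max: "\<And>G. \<lbrakk>G \<in> K; F \<subseteq> G\<rbrakk> \<Longrightarrow> G = F"
  shows "\<phi> F facet_of P"
proof -
  have FK: "F \<in> complex_faces K" using assms(1) by (auto simp: complex_faces_def)
  obtain G where G: "G facet_of P" "\<phi> F \<subseteq> G"
    using face_of_polyhedron_subset_facet[of P "\<phi> F"] polytope_imp_polyhedron[OF poly]
      face[OF FK] image_nonempty[OF FK assms(2)] by blast
  have "G face_of P" "G \<noteq> P" using G(1) by (auto simp: facet_of_def)
  then obtain T where T: "T \<in> complex_faces K" "G = \<phi> T" by (rule faceE)
  then have "F \<subseteq> T" using iso[OF FK] G(2) by blast
  moreover obtain H where "H \<in> K" "T \<subseteq> H" using T(1) by (auto simp: complex_faces_def)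
  ultimately have "T = F" using max by blast
  then show ?thesis using G T by simp
qed

text \<open>Faces of polyhedra are exposed. Of all vertices, the supporting hyperplane contains just
  those of \<open>F\<close>, so the inequality is strict at the others.\<close>

lemma facet_hyperplane:
  assumes "F \<in> K" "F \<noteq> {}" "\<And>G. \<lbrakk>G \<in> K; F \<subseteq> G\<rbrakk> \<Longrightarrow> G = F"
  obtains a b where "\<forall>i\<in>F. a \<bullet> vertex i = b"
    "\<forall>i\<in>\<Union>K - F. a \<bullet> vertex i < b"
proof -
  have FK: "F \<in> complex_faces K" using assms(1) by (auto simp: complex_faces_def)
  have "\<phi> F exposed_face_of P"
    using face[OF FK] exposed_face_of_polyhedron polytope_imp_polyhedron[OF poly] by blast
  then obtain a b where ab: "P \<subseteq> {x. a \<bullet> x \<le> b}" "\<phi> F = P \<inter> {x. a \<bullet> x = b}"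
    using face[OF FK] image_nonempty[OF FK assms(2)] unfolding exposed_face_of by blast
  have iff: "vertex i \<in> \<phi> F \<longleftrightarrow> i \<in> F" and P: "vertex i \<in> P" if "i \<in> \<Union>K" for i
  proof -
    have iK: "{i} \<in> complex_faces K" using that by (auto simp: complex_faces_def)
    then show "vertex i \<in> \<phi> F \<longleftrightarrow> i \<in> F" by (rule vertex_mem_iff[OF FK])
    show "vertex i \<in> P"
      using face[OF iK] image_singleton[OF iK] face_of_imp_subset by fastforce
  qed
  show ?thesis
  proof (rule that)
    show "\<forall>i\<in>F. a \<bullet> vertex i = b"
      using iff assms(1) ab(2) by blast
    show "\<forall>i\<in>\<Union>K - F. a \<bullet> vertex i < b"
    proof
      fix i assume "i \<in> \<Union>K - F"
      then show "a \<bullet> vertex i < b"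
        using iff[of i] P[of i] ab by (force simp: less_le)
    qed
  qed
qed

text \<open>A facet has dimension \<open>aff_dim P - 1\<close> and is here the hull of only
  \<open>aff_dim P\<close> distinct points, the least number that can span this dimension.\<close>

lemma affine_independent_facet:
  assumes "F \<in> K" "\<And>G. \<lbrakk>G \<in> K; F \<subseteq> G\<rbrakk> \<Longrightarrow> G = F" "finite F" "int (card F) = aff_dim P"
  shows "\<not> affine_dependent (vertex ` F)"
proof -
  have FK: "F \<in> complex_faces K" using assms(1) by (auto simp: complex_faces_def)
  have "F \<noteq> {}" using assms(4) dim by auto
  then have "aff_dim (vertex ` F) = aff_dim P - 1"
    using maximal_face_facet[OF assms(1) _ assms(2)] face_eq_convex_hull[OF FK]
    by (simp add: facet_of_def aff_dim_convex_hull)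
  moreover have "card (vertex ` F) = card F"
    using inj_on_vertex[OF FK] by (rule card_image)
  ultimately show ?thesis
    using assms(3,4) by (simp add: affine_independent_iff_card)
qed

end

section \<open>The core facets inside the complex\<close>

lemma NZ_gen_facets:
  assumes "F \<in> NZ_gen n"
  shows "F \<in> NZ_facets n" "antipode F \<in> NZ_facets n"
  using assms by (simp_all add: NZ_facets_def)

lemma core_facets_subset:
  assumes "6 \<le> n" "(a, b, c, d, e) \<in> core_facets"
  shows "{a, b, c, d, e} \<in> NZ_facets n"
proof -
  \<comment> \<open>The facts \<open>1\<close>, \<open>2\<close> and \<open>3\<close> address the
    blocks (2)(i), (2)(ii) and (3) of the union separately.\<close>
  have 1: "F \<in> NZ_gen n" if "1 \<le> i" "i \<le> l-5" "l-5 \<le> n-5"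
    "F \<in> {{i, i+1, l-3, l-2, l}, {i, i+1, l-3, l-1, l},
      {-i, -i-1, l-3, l-2, l}, {-i, -i-1, l-3, l-1, l}}" for i l F
    unfolding NZ_gen_def
    by (rule UnI1, rule UnI1, rule UnI2, rule CollectI, rule exI[of _ i], rule exI[of _ l])
      (intro conjI that)
  have 2: "F \<in> NZ_gen n" if "6 \<le> l" "l \<le> n"
    "F \<in> {{1, -(l-4), l-3, l-2, l}, {1, -(l-4), l-3, l-1, l},
      {1, -(l-4), -(l-3), l-2, l}, {1, -(l-4), -(l-2), l-1, l},
      {1, -(l-4), -(l-2), -(l-1), l}, {1, -(l-4), -(l-3), -(l-1), l},
      {-(l-4), -(l-3), -(l-2), l-1, l}, {-(l-4), -(l-3), -(l-2), -(l-1), l}}" for l F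
    unfolding NZ_gen_def
    by (rule UnI1, rule UnI2, rule CollectI, rule exI[of _ l]) (intro conjI that)
  have 3: "F \<in> NZ_gen n" if
    "F \<in> {{-1,2,-3,4,-5}, {1,2,-3,4,-5}, {1,2,3,4,-5}, {1,2,3,-4,-5}, {1,-2,-3,4,-5},
      {1,-2,3,4,-5}, {1,-2,3,-4,-5}, {-1,-2,-3,4,-5}, {-1,-2,3,4,-5}, {-1,-2,3,-4,-5}}" for F
    unfolding NZ_gen_def using that by (rule UnI2)
  \<comment> \<open>The generators of type (2) for \<open>l = 6\<close>, where \<open>i = 1\<close>
    is forced, and those of type (3). Every core facet is one of these or an antipode of
    one.\<close>
  define G :: "int set set" where
    "G = {{1, 2, 3, 4, 6}, {1, 2, 3, 5, 6}, {-1, -2, 3, 4, 6}, {-1, -2, 3, 5, 6},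
      {1, -2, 3, 4, 6}, {1, -2, 3, 5, 6}, {1, -2, -3, 4, 6}, {1, -2, -4, 5, 6},
      {1, -2, -4, -5, 6}, {1, -2, -3, -5, 6}, {-2, -3, -4, 5, 6}, {-2, -3, -4, -5, 6},
      {-1,2,-3,4,-5}, {1,2,-3,4,-5}, {1,2,3,4,-5}, {1,2,3,-4,-5}, {1,-2,-3,4,-5},
      {1,-2,3,4,-5}, {1,-2,3,-4,-5}, {-1,-2,-3,4,-5}, {-1,-2,3,4,-5}, {-1,-2,3,-4,-5}}"
  have "G \<subseteq> NZ_gen n"
    unfolding G_def insert_subset using assms(1) 1[of 1 6] 2[of 6] 3 by simp
  then have "\<forall>F\<in>G. F \<in> NZ_facets n \<and> antipode F \<in> NZ_facets n"
    using NZ_gen_facets by blast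
  then have mem: "\<forall>F\<in>G. F \<in> NZ_facets n" "\<forall>F\<in>G. antipode F \<in> NZ_facets n"
    by auto
  \<comment> \<open>Ordered rewriting with \<open>insert_commute\<close> gives equal sets the same
    syntactic form.\<close>
  note mem = mem[unfolded G_def antipode_def, simplified, simplified insert_commute]
  show ?thesis
    using assms(2) unfolding core_facets_def insert_iff empty_iff prod.inject simp_thms
    by (elim disjE; elim conjE; hypsubst; insert mem; simp only: insert_commute; elim conjE; assumption)
qed

text \<open>The upper bound is what maximality needs: a five-element member cannot be properly
  contained in another one.\<close>

lemma card_NZ_facets:
  assumes "F \<in> NZ_facets n"
  shows "finite F" "card F \<le> 5"
proof -
  have five: "card {a, b, c, d, e :: int} \<le> 5" for a b c d e
    by (simp add: card_insert_if)
  have "finite F \<and> card F \<le> 5" if "F \<in> NZ_gen n" for F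
    using that unfolding NZ_gen_def by (auto intro: five)
  moreover have "card (antipode F) = card F" for F
    unfolding antipode_def by (rule card_image) simp
  ultimately show "finite F" "card F \<le> 5"
    using assms unfolding NZ_facets_def by (auto simp: antipode_def)
qed

lemma core_vertices_subset:
  assumes "6 \<le> n"
  shows "core_vertices \<subseteq> \<Union>(NZ_facets n)"
proof -
  have "{-5, -3, -2, 1, 6} \<in> NZ_facets n" "{-6, -1, 2, 4, 5} \<in> NZ_facets n"
    "{-2, -5, -1, 3, 4} \<in> NZ_facets n" "{-4, -3, 1, 2, 5} \<in> NZ_facets n"
    by (rule core_facets_subset[OF assms], simp add: core_facets_def)+
  then have "{-5, -3, -2, 1, 6} \<union> {-6, -1, 2, 4, 5} \<union> {-2, -5, -1, 3, 4} \<union> {-4, -3, 1, 2, 5}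
      \<subseteq> \<Union>(NZ_facets n)"
    by (intro Un_least Union_upper)
  then show ?thesis by (simp add: core_vertices_def)
qed

section \<open>Brackets of a hypothetical realization\<close>

theorem mainTheorem8:
  fixes n :: int
  assumes "n \<ge> 6"
  shows "\<not> realizable_5 (NZ_facets n)"
proof
  let ?K = "NZ_facets n"
  assume "realizable_5 ?K"
  then obtain P :: "(real^5) set" and \<phi> where P: "polytope P" "aff_dim P = 5"
    and bij: "bij_betw \<phi> (complex_faces ?K) (boundary_faces P)"
    and iso: "\<forall>S\<in>complex_faces ?K. \<forall>T\<in>complex_faces ?K. S \<subseteq> T \<longleftrightarrow> \<phi> S \<subseteq> \<phi> T"
    unfolding realizable_5_def by blast
  interpret realization ?K P \<phi>
  proof
    show "?K \<noteq> {}" using core_vertices_subset[OF assms] by (auto simp: core_vertices_def)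
  qed (use P bij iso in auto)
  \<comment> \<open>Homogenized vertices live in a product space; a linear isomorphism moves them to
    the space in which \<open>bracket\<close> is defined.\<close>
  have "DIM((real^5) \<times> real) = DIM(real^6)" by simp
  then obtain f :: "(real^5) \<times> real \<Rightarrow> real^6" and g
    where fg: "linear f" "linear g" "\<And>x. g (f x) = x"
    by (rule isomorphisms_UNIV_UNIV) blast
  have "inj f" using fg(3) by (rule inj_on_inverseI)
  define w where "w i = f (vertex i, 1)" for i
  define C where "C a b c d e f = bracket (w a) (w b) (w c) (w d) (w e) (w f)" for a b c d e f
  have facet: "0 < C a b c d e x * C a b c d e y"
    if F: "(a, b, c, d, e) \<in> core_facets"
      and x: "x \<in> core_vertices - {a, b, c, d, e}" and y: "y \<in> core_vertices - {a, b, c, d, e}"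
    for a b c d e x y
  proof -
    let ?F = "{a, b, c, d, e}"
    have FK: "?F \<in> ?K" by (rule core_facets_subset[OF assms F])
    have dist: "distinct [a, b, c, d, e]" using F by (auto simp: core_facets_def)
    have card: "card ?F = 5" using distinct_card[OF dist] by simp
    have max: "G = ?F" if "G \<in> ?K" "?F \<subseteq> G" for G
      using card_seteq[OF card_NZ_facets(1)[OF that(1)] that(2)] card_NZ_facets(2)[OF that(1)] card
      by simp
    have ne: "?F \<noteq> {}" by simp
    obtain u t where ut: "\<forall>i\<in>?F. u \<bullet> vertex i = t"
        "\<forall>i\<in>\<Union>?K - ?F. u \<bullet> vertex i < t"
      by (rule facet_hyperplane[OF FK ne max])
    \<comment> \<open>The homogeneous form of the affine function \<open>t - u \<bullet> x\<close>,
      which vanishes on the facet and is positive at all other vertices.\<close>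
    define L where "L z = t * snd (g z) - u \<bullet> fst (g z)" for z
    have lin: "linear L"
      by (rule linearI)
        (simp_all add: L_def linear_add[OF fg(2)] linear_cmul[OF fg(2)] inner_add_right algebra_simps)
    have Lw: "L (w i) = t - u \<bullet> vertex i" for i
      by (simp add: L_def w_def fg(3))
    have zero: "L (w i) = 0" if "i \<in> ?F" for i
      using bspec[OF ut(1) that] by (simp add: Lw)
    have pos: "0 < L (w i)" if "i \<in> core_vertices - ?F" for i
    proof -
      have "i \<in> \<Union>?K - ?F" using that core_vertices_subset[OF assms] by blast
      from bspec[OF ut(2) this] show ?thesis by (simp add: Lw)
    qed
    have inj: "inj_on w ?F"
    proof (rule inj_onI)
      fix i j assume ij: "i \<in> ?F" "j \<in> ?F" and "w i = w j"
      then have "g (w i) = g (w j)" by simp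
      then have "vertex i = vertex j" by (simp add: w_def fg(3))
      moreover have "?F \<in> complex_faces ?K" using FK unfolding complex_faces_def by blast
      ultimately show "i = j" using inj_onD[OF inj_on_vertex _ ij] by blast
    qed
    have dist_w: "distinct [w a, w b, w c, w d, w e]"
      using distinct_map[of w "[a, b, c, d, e]"] dist inj by (simp only: list.map list.set simp_thms)
    have ind: "independent {w a, w b, w c, w d, w e}"
    proof -
      \<comment> \<open>The facet has five vertices and \<open>P\<close> has dimension 5, so its
        vertices are affinely independent; homogenizing and applying the injective \<open>f\<close>
        make them linearly independent.\<close>
      have "\<not> affine_dependent (vertex ` ?F)"
      proof (rule affine_independent_facet[OF FK max])
        show "int (card ?F) = aff_dim P" by (simp only: card P(2) of_nat_numeral)
      qed simp_all
      then have "independent ((\<lambda>x. (x, 1::real)) ` vertex ` ?F)"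
        by (rule independent_homogenize)
      from linear_independent_injective_image[OF fg(1) this inj_on_subset[OF \<open>inj f\<close> subset_UNIV]]
      show ?thesis by (simp add: w_def)
    qed
    show ?thesis
      unfolding C_def
      by (rule bracket_same_side[OF lin zero zero zero zero zero pos[OF x] pos[OF y] dist_w ind])
        simp_all
  qed
  have "chirotope C"
    by (unfold_locales, unfold C_def)
      ((rule bracket_swap bracket_Grassmann_Pluecker facet[unfolded C_def] | assumption)+)
  then show False by (rule chirotope.inconsistent)
qed

end
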